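(* Let $\mathbb{K}$ be an associative ring with unity (not necessarily commutative). Let $p,q$ be positive integers and let $P=[p]\times[q]$ be the $p\times q$-rectangle. Fix $\ell\in\mathbb{N}$, and let $f\in\mathbb{K}^{\widehat{P}}$ be a $\mathbb{K}$-labeling of $P$ such that $R^{\ell}f\neq\bot$, where $R$ is birational rowmotion of $P$. Set $a=f(0)$ and $b=f(1)$. Let $(i,j)\in P$ satisfy $\ell-i-j+1\geq 0$. Then $$\left(R^{\ell}f\right)(i,j)=a\cdot\Big(\left(R^{\ell-i-j+1}f\right)(p+1-i,\;q+1-j)\Big)^{-1}\cdot b.$$
   Context: $\mathbb{K}$ is a fixed associative ring with unity, not necessarily commutative. An element is invertible if it has a two-sided inverse $x^{-1}$. An equality in which an inverse $x^{-1}$ appears is understood to include the assertion that $x$ is invertible (unless this is assumed). $\mathbb{N}=\{0,1,2,\ldots\}$. Extended poset. For a finite poset $P$, $\widehat{P}$ is the poset on the disjoint union $P\sqcup\{0,1\}$ in which $u\le v$ iff ($u,v\in P$ and $u\le v$ in $P$) or $u=0$ or $v=1$. Write $u\lessdot v$ (equivalently $v\gtrdot u$) if $u<v$ and no $w$ satisfies $u<w<v$ (in $\widehat{P}$). Labelings and partial maps. A $\mathbb{K}$-labeling of $P$ is a map $f:\widehat{P}\to\mathbb{K}$; the set of these is $\mathbb{K}^{\widehat{P}}$. For $(i,j)\in P$ write $f(i,j)$ for $f((i,j))$. A partial map $F:X\dashrightarrow Y$ is a map $X\to Y\sqcup\{\bot\}$, where $\bot$ means "undefined"; it is extended by $F(\bot)=\bot$,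 and partial maps are composed accordingly. Toggles. For $v\in P$, the toggle $T_v:\mathbb{K}^{\widehat{P}}\dashrightarrow\mathbb{K}^{\widehat{P}}$ is defined by $(T_vf)(w)=f(w)$ for $w\ne v$ and $$(T_vf)(v)=\Big(\sum_{u\in\widehat{P},\,u\lessdot v}f(u)\Big)\cdot f(v)^{-1}\cdot\Big(\sum_{u\in\widehat{P},\,u\gtrdot v}f(u)^{-1}\Big)^{-1};$$ if any inverse in this formula does not exist, then $T_vf:=\bot$. Birational rowmotion. $R:=T_{v_1}\circ T_{v_2}\circ\cdots\circ T_{v_m}:\mathbb{K}^{\widehat{P}}\dashrightarrow\mathbb{K}^{\widehat{P}}$, where $(v_1,\ldots,v_m)$ is any linear extension of $P$ (a list of all elements of $P$, each exactly once, such that $v_i<v_j$ implies $i<j$); so the toggles at larger elements are applied first. This partial map does not depend on the choice of linear extension. $R^k$ is the $k$-fold composition, $R^0=\mathrm{id}$. Rectangle. For positive integers $p,q$, the $p\times q$-rectangle is $[p]\times[q]$ with $[n]=\{1,\ldots,n\}$ and order $(i,j)\le(i',j')$ iff $i\le i'$ and $j\le j'$. *)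

theory Defs
  imports Main "HOL-Library.Extended" "HOL-Library.Product_Order"
begin

text \<open>
  The base ring is a type of sort \<open>{ring, monoid_mult}\<close>: an associative ring with unity, not
  necessarily commutative. Unlike \<open>ring_1\<close>, this sort does not exclude the trivial ring.
\<close>

definition ring_invertible :: "'k::monoid_mult \<Rightarrow> bool" where
  "ring_invertible x \<longleftrightarrow> (\<exists>y. x * y = 1 \<and> y * x = 1)"

text \<open>Only meaningful for invertible arguments; every use below is guarded by \<^const>\<open>ring_invertible\<close>.\<close>

definition ring_inv :: "'k::monoid_mult \<Rightarrow> 'k" where
  "ring_inv x = (THE y. x * y = 1 \<and> y * x = 1)"

text \<open>
  A finite poset is a finite subset \<open>P\<close> of an ordered type, with the induced order. In the
  extended poset, \<^const>\<open>Minf\<close> and \<^const>\<open>Pinf\<close> play the roles of the added elements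
  \<open>0\<close> and \<open>1\<close>; the order on \<^typ>\<open>'v::order extended\<close> is the required one.
\<close>

definition ext_poset :: "'v set \<Rightarrow> 'v extended set" where
  "ext_poset P = {Minf, Pinf} \<union> Fin ` P"

definition covered_in :: "'v::order set \<Rightarrow> 'v extended \<Rightarrow> 'v extended \<Rightarrow> bool" where
  "covered_in P u v \<longleftrightarrow> u \<in> ext_poset P \<and> v \<in> ext_poset P \<and> u < v \<and>
     \<not> (\<exists>w \<in> ext_poset P. u < w \<and> w < v)"

text \<open>
  A labeling is a function on \<^typ>\<open>'v extended\<close>; its values outside \<^term>\<open>ext_poset P\<close>
  are never read or changed. A partial map into \<^typ>\<open>'y\<close> is a function into
  \<^typ>\<open>'y option\<close>, where \<^const>\<open>None\<close> stands for ``undefined''.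
\<close>

type_synonym ('v, 'k) labeling = "'v extended \<Rightarrow> 'k"

definition toggle ::
  "'v::order set \<Rightarrow> 'v \<Rightarrow> ('v, 'k::{ring, monoid_mult}) labeling \<Rightarrow> ('v, 'k) labeling option" where
  "toggle P v f =
    (let lo = (\<Sum>u | covered_in P u (Fin v). f u);
         hi = (\<Sum>u | covered_in P (Fin v) u. ring_inv (f u))
     in if ring_invertible (f (Fin v)) \<and>
           (\<forall>u. covered_in P (Fin v) u \<longrightarrow> ring_invertible (f u)) \<and>
           ring_invertible hi
        then Some (f(Fin v := lo * ring_inv (f (Fin v)) * ring_inv hi))
        else None)"

definition linear_extension :: "'v::order set \<Rightarrow> 'v list \<Rightarrow> bool" where
  "linear_extension P vs \<longleftrightarrow> set vs = P \<and> distinct vs \<and>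
     (\<forall>i < length vs. \<forall>j < length vs. vs ! i < vs ! j \<longrightarrow> i < j)"

lemma linear_extension_exists:
  assumes "finite P"
  shows "\<exists>vs. linear_extension P vs"
  using assms
proof (induction P rule: finite_psubset_induct)
  case (psubset P)
  show ?case
  proof (cases "P = {}")
    case True
    then show ?thesis by (auto simp: linear_extension_def)
  next
    case False
    then obtain m where m: "m \<in> P" "\<And>x. x \<in> P \<Longrightarrow> m \<le> x \<Longrightarrow> x = m"
      using finite_has_maximal[OF psubset.hyps] by metis
    obtain vs where vs: "linear_extension (P - {m}) vs"
      using psubset.IH[of "P - {m}"] m(1) by blast
    have "i < j" if "i < length (vs @ [m])" "j < length (vs @ [m])"
      "(vs @ [m]) ! i < (vs @ [m]) ! j" for i j
    proof (cases "i < length vs")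
      case True
      with that vs show ?thesis
        by (auto simp: linear_extension_def nth_append split: if_splits)
    next
      case False
      then have "(vs @ [m]) ! i = m" using that(1) by (auto simp: nth_append)
      moreover have "(vs @ [m]) ! j \<in> P"
        using nth_mem[OF that(2)] vs m(1) by (auto simp: linear_extension_def)
      ultimately show ?thesis using that(3) m(2) by force
    qed
    moreover have "set (vs @ [m]) = P" "distinct (vs @ [m])"
      using vs m(1) by (auto simp: linear_extension_def)
    ultimately have "linear_extension P (vs @ [m])"
      unfolding linear_extension_def by blast
    then show ?thesis by blast
  qed
qed

text \<open>
  Birational rowmotion \<open>T\<^sub>v\<^sub>1 \<circ> \<dots> \<circ> T\<^sub>v\<^sub>m\<close>, computed along a given linear extension
  \<open>vs = [v\<^sub>1, \<dots>, v\<^sub>m]\<close> of \<open>P\<close>: the toggle at the last element of \<open>vs\<close> is applied first.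
\<close>

definition rowmotion ::
  "'v::order set \<Rightarrow> 'v list \<Rightarrow> ('v, 'k::{ring, monoid_mult}) labeling \<Rightarrow> ('v, 'k) labeling option" where
  "rowmotion P vs = foldr (\<lambda>v F. toggle P v \<circ>\<^sub>m F) vs Some"

primrec partial_power :: "('x \<Rightarrow> 'x option) \<Rightarrow> nat \<Rightarrow> 'x \<Rightarrow> 'x option" where
  "partial_power F 0 = Some"
| "partial_power F (Suc k) = F \<circ>\<^sub>m partial_power F k"

definition rectangle :: "nat \<Rightarrow> nat \<Rightarrow> (nat \<times> nat) set" where
  "rectangle p q = {1..p} \<times> {1..q}"

end

theory Submission
  imports Defs
begin

text \<open>
  Write \<open>v\<^sub>m\<close> for the label of \<open>v\<close> after \<open>m\<close> steps, and put
  \<open>A\<^sub>m(v) = v\<^sub>m (\<Sum>\<^bsub>u \<lessdot> v\<^esub> u\<^sub>m)\<^sup>-\<^sup>1\<close>. The definition of rowmotion says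
  that also \<open>A\<^sub>m(v) = (\<Sum>\<^bsub>u \<gtrdot> v\<^esub> u\<^bsub>m+1\<^esub>\<^sup>-\<^sup>1)\<^sup>-\<^sup>1 v\<^bsub>m+1\<^esub>\<^sup>-\<^sup>1\<close>.
  Summing products of these weights over descending paths, the first formula gives
  \<open>v\<^sub>m = A\<^sub>m[v \<rightarrow> (1,1)] a\<close> and the second gives
  \<open>v\<^bsub>m+1\<^esub>\<^sup>-\<^sup>1 = b\<^sup>-\<^sup>1 A\<^sub>m[(p,q) \<rightarrow> v]\<close>. A telescoping argument shows
  \<open>A\<^bsub>m+1\<^esub>[(k+1,q) \<rightarrow> (d+1,1)] = A\<^sub>m[(k,q) \<rightarrow> (d,1)]\<close>; iterating it proves reciprocity
  for \<open>(i,1)\<close>. From there induction on \<open>j\<close> propagates it: the transition equation at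
  \<open>(i,j)\<close> and the one at its antipode determine the label at \<open>(i,j+1)\<close> in the same way.
\<close>

section \<open>Weighted path sums over the rectangle\<close>

lemma mem_rectangle: "(i, j) \<in> rectangle p q \<longleftrightarrow> 1 \<le> i \<and> i \<le> p \<and> 1 \<le> j \<and> j \<le> q"
  by (auto simp: rectangle_def)

text \<open>
  The sum, over all paths descending from \<open>(i, j)\<close> to \<open>(d, e)\<close>, of the product of the
  weights \<open>A\<close> along the path.
\<close>

fun path_sum :: "(nat \<Rightarrow> nat \<Rightarrow> 'k) \<Rightarrow> nat \<Rightarrow> nat \<Rightarrow> nat \<Rightarrow> nat \<Rightarrow> 'k::{ring, monoid_mult}" where
  "path_sum A d e 0 j = 0"
| "path_sum A d e (Suc i) 0 = 0"
| "path_sum A d e (Suc i) (Suc j) =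
     A (Suc i) (Suc j) *
       ((if Suc i = d \<and> Suc j = e then 1 else 0) + path_sum A d e i (Suc j) + path_sum A d e (Suc i) j)"

lemma path_sum_0_right [simp]: "path_sum A d e i 0 = 0"
  by (cases i) auto

lemma path_sum_eq_0: "A i j = 0 \<Longrightarrow> path_sum A d e i j = 0"
  by (cases i; cases j) auto

lemma path_sum_rec:
  "1 \<le> i \<Longrightarrow> 1 \<le> j \<Longrightarrow> path_sum A d e i j =
     A i j * ((if i = d \<and> j = e then 1 else 0) + path_sum A d e (i - 1) j + path_sum A d e i (j - 1))"
  by (cases i; cases j) auto

text \<open>The two assumptions kill the end terms: the one at \<open>i = 0\<close>, where
  \<open>i - 1\<close> truncates, and the additional one at \<open>Suc n\<close>.\<close>

lemma sum_shift:
  fixes u w :: "nat \<Rightarrow> 'k::semiring_0"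
  assumes "u 0 = 0" "u (Suc n) = 0"
  shows "(\<Sum>i\<le>n. u i * w (i - 1)) = (\<Sum>i\<le>n. u (Suc i) * w i)"
proof -
  have "(\<Sum>i\<le>n. u i * w (i - 1)) = (\<Sum>i\<le>Suc n. u i * w (i - 1))"
    using assms(2) by simp
  also have "\<dots> = (\<Sum>i\<le>n. u (Suc i) * w i)"
    using assms(1) by (subst sum.atMost_Suc_shift) simp
  finally show ?thesis .
qed

section \<open>Reciprocity for families satisfying the transition equations\<close>

text \<open>
  \<open>X m\<close> holds the labels after \<open>m\<close> steps, \<open>Y m\<close> their inverses, and \<open>a\<close>, \<open>b\<close> are the
  labels of the added minimum and maximum. All families are extended by \<open>0\<close> outside the
  rectangle, so that sums over covers need no case distinction at the border.
\<close>

locale rectangle_orbit =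
  fixes p q N :: nat
    and X Y A :: "nat \<Rightarrow> nat \<Rightarrow> nat \<Rightarrow> 'k::{ring, monoid_mult}"
    and a a' b b' :: 'k
  assumes pos: "0 < p" "0 < q"
    and a_inv: "a * a' = 1" "a' * a = 1"
    and b_inv: "b * b' = 1" "b' * b = 1"
    and outside: "(i, j) \<notin> rectangle p q \<Longrightarrow> X m i j = 0"
      "(i, j) \<notin> rectangle p q \<Longrightarrow> Y m i j = 0"
      "(i, j) \<notin> rectangle p q \<Longrightarrow> A m i j = 0"
    and X_Y: "m \<le> N \<Longrightarrow> (i, j) \<in> rectangle p q \<Longrightarrow> X m i j * Y m i j = 1"
    and Y_X: "m \<le> N \<Longrightarrow> (i, j) \<in> rectangle p q \<Longrightarrow> Y m i j * X m i j = 1"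
    and A_lo: "m < N \<Longrightarrow> (i, j) \<in> rectangle p q \<Longrightarrow>
      A m i j * ((if i = 1 \<and> j = 1 then a else 0) + X m (i - 1) j + X m i (j - 1)) = X m i j"
    and hi_A: "m < N \<Longrightarrow> (i, j) \<in> rectangle p q \<Longrightarrow>
      ((if i = p \<and> j = q then b' else 0) + Y (Suc m) (Suc i) j + Y (Suc m) i (Suc j)) * A m i j
        = Y (Suc m) i j"
begin

lemma boundary [simp]:
  "X m 0 j = 0" "X m i 0 = 0" "Y m 0 j = 0" "Y m i 0 = 0"
  "X m (Suc p) j = 0" "X m i (Suc q) = 0" "Y m (Suc p) j = 0" "Y m i (Suc q) = 0"
  by (auto intro!: outside simp: mem_rectangle)

text \<open>By \<open>A_lo\<close> the labels obey the recursion of \<open>path_sum\<close>, with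
  \<open>a\<close> in place of \<open>1\<close> as the contribution of the end cell
  \<open>(1, 1)\<close>.\<close>

lemma X_path_sum:
  assumes "m < N"
  shows "X m i j = path_sum (A m) 1 1 i j * a"
  using assms
proof (induction "A m" "1::nat" "1::nat" i j rule: path_sum.induct)
  case (3 i j)
  show ?case
  proof (cases "(Suc i, Suc j) \<in> rectangle p q")
    case True
    have "(if Suc i = 1 \<and> Suc j = 1 then a else 0) = (if Suc i = 1 \<and> Suc j = 1 then 1 else 0) * a"
      by simp
    then show ?thesis
      using A_lo[OF 3(3) True] 3(1,2)[OF 3(3)]
      by (simp only: path_sum.simps diff_Suc_1 mult.assoc distrib_right)
  qed (simp add: outside path_sum_eq_0)
qed auto

text \<open>\<open>path_sum\<close> recurses at the start of the paths but \<open>hi_A\<close> at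
  their end, so plain induction does not match. Instead \<open>U i j * V i j\<close> is summed over
  the grid in two ways; after a shift all terms but \<open>U d e\<close> and
  \<open>b' * W p q\<close> cancel.\<close>

lemma Y_path_sum:
  assumes "m < N" and de: "(d, e) \<in> rectangle p q"
  shows "Y (Suc m) d e = b' * path_sum (A m) d e p q"
proof -
  define W where "W = path_sum (A m) d e"
  define U where "U = Y (Suc m)"
  define V where "V i j = (if i = d \<and> j = e then 1 else 0) + W (i - 1) j + W i (j - 1)" for i j
  \<comment> \<open>The weight changes sides: \<open>U i j\<close> ends in the factor
    \<open>A m i j\<close>, and \<open>A m i j * V i j\<close> is \<open>W i j\<close>.\<close>
  have loc: "U i j * V i j =
      (if i = p \<and> j = q then b' * W i j else 0) + U (Suc i) j * W i j + U i (Suc j) * W i j" for i j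
  proof (cases "(i, j) \<in> rectangle p q")
    case True
    then have "W i j = A m i j * V i j"
      unfolding W_def V_def by (intro path_sum_rec) (auto simp: mem_rectangle)
    then have "U i j * V i j = ((if i = p \<and> j = q then b' else 0) + U (Suc i) j + U i (Suc j)) * W i j"
      using hi_A[OF \<open>m < N\<close> True] by (simp only: U_def mult.assoc[symmetric])
    then show ?thesis by (auto simp: distrib_right)
  qed (use pos in \<open>auto simp: U_def W_def outside path_sum_eq_0 mem_rectangle\<close>)
  have shift1: "(\<Sum>i\<le>p. U i j * W (i - 1) j) = (\<Sum>i\<le>p. U (Suc i) j * W i j)" for j
    by (rule sum_shift) (simp_all add: U_def)
  have shift2: "(\<Sum>j\<le>q. U i j * W i (j - 1)) = (\<Sum>j\<le>q. U i (Suc j) * W i j)" for i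
    by (rule sum_shift) (simp_all add: U_def)
  have "(\<Sum>i\<le>p. \<Sum>j\<le>q. U i j * V i j)
      = U d e + (\<Sum>i\<le>p. \<Sum>j\<le>q. U i j * W (i - 1) j) + (\<Sum>i\<le>p. \<Sum>j\<le>q. U i j * W i (j - 1))"
  proof -
    have "(\<Sum>i\<le>p. \<Sum>j\<le>q. U i j * (if i = d \<and> j = e then 1 else 0)) =
      (\<Sum>i\<le>p. if i = d then (\<Sum>j\<le>q. if j = e then U i j else 0) else 0)"
      by (auto intro!: sum.cong simp del: sum.delta sum.delta')
    also have "\<dots> = U d e"
      using de by (simp add: mem_rectangle)
    finally show ?thesis by (simp add: V_def distrib_left sum.distrib)
  qed
  also have "(\<Sum>i\<le>p. \<Sum>j\<le>q. U i j * W (i - 1) j) = (\<Sum>i\<le>p. \<Sum>j\<le>q. U (Suc i) j * W i j)"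
    using shift1 by (subst (1 2) sum.swap) simp
  also have "(\<Sum>i\<le>p. \<Sum>j\<le>q. U i j * W i (j - 1)) = (\<Sum>i\<le>p. \<Sum>j\<le>q. U i (Suc j) * W i j)"
    by (simp only: shift2)
  also have "(\<Sum>i\<le>p. \<Sum>j\<le>q. U i j * V i j)
      = b' * W p q + (\<Sum>i\<le>p. \<Sum>j\<le>q. U (Suc i) j * W i j) + (\<Sum>i\<le>p. \<Sum>j\<le>q. U i (Suc j) * W i j)"
  proof -
    have "(\<Sum>i\<le>p. \<Sum>j\<le>q. if i = p \<and> j = q then b' * W i j else 0) =
      (\<Sum>i\<le>p. if i = p then (\<Sum>j\<le>q. if j = q then b' * W i j else 0) else 0)"
      by (auto intro!: sum.cong simp del: sum.delta sum.delta')
    also have "\<dots> = b' * W p q" by simp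
    finally show ?thesis by (simp add: loc sum.distrib)
  qed
  finally show ?thesis by (simp add: U_def W_def)
qed

text \<open>
  Consider descents from \<open>(Suc k, q)\<close> to \<open>(d, 1)\<close> one of whose steps is a jump, from a cell
  \<open>s\<close> to a cell \<open>z\<close> one rank lower with strictly smaller first coordinate. Cells before \<open>s\<close>
  are weighted by \<open>A (Suc m)\<close>, the jump by \<open>X s * Y z\<close>, cells after \<open>z\<close> by \<open>A m\<close>. The total
  weight does not depend on which step is the jump; the two sides are the cases where it is the
  last and the first step. Below, \<open>U x y * M x (x + y - 1)\<close> is the total weight of the descents
  from \<open>(x, y)\<close> that start with the jump.
\<close>

lemma path_sum_conversion:
  assumes m: "Suc m < N" and d: "1 \<le> d" and k: "1 \<le> k" "Suc k \<le> p"
  shows "path_sum (A (Suc m)) (Suc d) 1 (Suc k) q = path_sum (A m) d 1 k q"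
proof -
  define W where "W = path_sum (A m) d 1"
  define U where "U = X (Suc m)"
  define Z where "Z = Y (Suc m)"
  define V where "V i j = (if i = d \<and> j = 1 then 1 else 0) + W (i - 1) j + W i (j - 1)" for i j
  \<comment> \<open>The cells \<open>(i, n - i)\<close> are where the jump may land, and
    \<open>V\<close> weighs the rest of the descent. If \<open>n - i\<close> truncates to
    \<open>0\<close>, then \<open>Z\<close> vanishes there.\<close>
  define M where "M x n = (\<Sum>i<x. Z i (n - i) * V i (n - i))" for x n
  \<comment> \<open>\<open>i < p\<close> keeps away from \<open>(p, q)\<close>, the only cell where
    \<open>hi_A\<close> has the term \<open>b'\<close>.\<close>
  have Z_V: "Z i j * V i j = (Z (Suc i) j + Z i (Suc j)) * W i j" if "i < p" for i j
  proof (cases "(i, j) \<in> rectangle p q")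
    case True
    then have "W i j = A m i j * V i j"
      unfolding W_def V_def by (intro path_sum_rec) (auto simp: mem_rectangle)
    moreover have "Z i j = (Z (Suc i) j + Z i (Suc j)) * A m i j"
      using hi_A[of m i j] True that m by (simp add: Z_def)
    ultimately show ?thesis by (simp add: mult.assoc)
  qed (auto simp: Z_def W_def outside path_sum_eq_0)
  \<comment> \<open>Expanding \<open>V\<close> leads one rank down. After a shift, neighbouring
    \<open>W\<close> terms recombine by \<open>Z_V\<close>; only the one at \<open>i = x\<close> has
    no partner.\<close>
  have M_rec: "M (Suc x) (Suc (x + y)) =
      (if x = d \<and> y = 0 then Z d 1 else 0) + M x (x + y) + Z x (Suc y) * W x y" if "x < p" for x y
  proof -
    let ?c = "\<lambda>i. x + y - i"
    have "M (Suc x) (Suc (x + y)) = (\<Sum>i<Suc x. Z i (Suc (?c i)) * V i (Suc (?c i)))"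
      unfolding M_def by (intro sum.cong) (auto simp: Suc_diff_le)
    also have "\<dots> = (\<Sum>i<Suc x. Z i (Suc (?c i)) * (if i = d \<and> ?c i = 0 then 1 else 0))
        + (\<Sum>i<Suc x. Z i (Suc (?c i)) * W (i - 1) (Suc (?c i)))
        + (\<Sum>i<Suc x. Z i (Suc (?c i)) * W i (?c i))"
      by (simp only: V_def distrib_left sum.distrib diff_Suc_Suc diff_zero One_nat_def nat.inject)
    also have "(\<Sum>i<Suc x. Z i (Suc (?c i)) * (if i = d \<and> ?c i = 0 then 1 else 0))
        = (\<Sum>i<Suc x. if i = d then (if x = d \<and> y = 0 then Z d 1 else 0) else 0)"
      by (intro sum.cong) auto
    also have "\<dots> = (if x = d \<and> y = 0 then Z d 1 else 0)"
      by (subst sum.delta) auto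
    also have "(\<Sum>i<Suc x. Z i (Suc (?c i)) * W (i - 1) (Suc (?c i)))
        = (\<Sum>i<x. Z (Suc i) (?c i) * W i (?c i))"
      by (subst sum.lessThan_Suc_shift) (auto simp: Z_def Suc_diff_Suc intro!: sum.cong)
    also have "(\<Sum>i<Suc x. Z i (Suc (?c i)) * W i (?c i))
        = (\<Sum>i<x. Z i (Suc (?c i)) * W i (?c i)) + Z x (Suc y) * W x y"
      by simp
    finally show ?thesis
      using that by (simp add: M_def Z_V distrib_right sum.distrib add.assoc)
  qed
  \<comment> \<open>Unfolding the label at the start of the jump by \<open>A_lo\<close> postpones
    the jump by one step.\<close>
  have L: "U i j * M i (i + j - 1) = path_sum (A (Suc m)) (Suc d) 1 i j" if "i \<le> p" for i j
    using that
  proof (induction "A (Suc m)" "Suc d" "1::nat" i j rule: path_sum.induct)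
    case (3 x y)
    show ?case
    proof (cases "(Suc x, Suc y) \<in> rectangle p q")
      case True
      let ?lo = "(if x = 0 \<and> y = 0 then a else 0) + U x (Suc y) + U (Suc x) y"
      have xp: "x < p" using 3(3) by simp
      have lo: "U (Suc x) (Suc y) = A (Suc m) (Suc x) (Suc y) * ?lo"
        using A_lo[OF m True] by (simp add: U_def)
      have UZ: "U i j * Z i j = 1" if "(i, j) \<in> rectangle p q" for i j
        using X_Y[OF _ that] m by (simp add: U_def Z_def)
      \<comment> \<open>Trades the unpaired term of \<open>M_rec\<close> under
        \<open>U x (Suc y)\<close> for the term that \<open>U (Suc x) y\<close> needs in
        \<open>M1\<close>. Inside the rectangle both products of a label and its inverse are
        \<open>1\<close>; otherwise \<open>W x y = 0\<close>.\<close>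
      have corner: "U x (Suc y) * Z x (Suc y) * W x y = U (Suc x) y * Z (Suc x) y * W x y"
      proof (cases "1 \<le> x \<and> 1 \<le> y")
        case True
        with \<open>(Suc x, Suc y) \<in> _\<close> show ?thesis by (simp add: UZ mem_rectangle)
      next
        case False
        then show ?thesis by (cases x; cases y) (auto simp: W_def)
      qed
      have M1: "M (Suc x) (x + y) = M x (x + y) + (Z (Suc x) y + Z x (Suc y)) * W x y"
        using Z_V[OF xp, of y] by (simp add: M_def)
      \<comment> \<open>The last possible jump, from \<open>(Suc d, 1)\<close> to
        \<open>(d, 1)\<close>: since \<open>d\<close> is positive, \<open>?lo\<close> reduces to
        \<open>U d 1\<close> there and cancels \<open>Z d 1\<close>.\<close>
      have source: "?lo * (if x = d \<and> y = 0 then Z d 1 else 0) = (if x = d \<and> y = 0 then 1 else 0)"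
        using UZ[of d 1] d True by (auto simp: U_def mem_rectangle)
      have zero: "(if x = 0 \<and> y = 0 then a else 0) * (M x (x + y) + Z x (Suc y) * W x y) = 0"
        by (simp add: M_def W_def)
      have "?lo * M (Suc x) (Suc (x + y)) = (if x = d \<and> y = 0 then 1 else 0)
          + (U x (Suc y) + U (Suc x) y) * (M x (x + y) + Z x (Suc y) * W x y)"
      proof -
        let ?S = "M x (x + y) + Z x (Suc y) * W x y"
        have "?lo * M (Suc x) (Suc (x + y)) = ?lo * ((if x = d \<and> y = 0 then Z d 1 else 0) + ?S)"
          by (simp only: M_rec[OF xp] add.assoc)
        also have "\<dots> = (if x = d \<and> y = 0 then 1 else 0) + ?lo * ?S"
          by (simp only: distrib_left[of ?lo] source)
        also have "?lo * ?S = (U x (Suc y) + U (Suc x) y) * ?S"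
          by (simp only: add.assoc distrib_right[of _ _ ?S] zero add_0_left)
        finally show ?thesis .
      qed
      also have "\<dots> = (if x = d \<and> y = 0 then 1 else 0)
          + U x (Suc y) * M x (x + y) + U (Suc x) y * M (Suc x) (x + y)"
        using corner by (simp add: M1 algebra_simps)
      finally have "?lo * M (Suc x) (Suc (x + y)) = \<dots>" .
      moreover have "U x (Suc y) * M x (x + y) = path_sum (A (Suc m)) (Suc d) 1 x (Suc y)"
        using 3(1) 3(3) by simp
      moreover have "U (Suc x) y * M (Suc x) (x + y) = path_sum (A (Suc m)) (Suc d) 1 (Suc x) y"
        using 3(2) 3(3) by simp
      ultimately show ?thesis
        by (simp add: lo mult.assoc)
    qed (simp add: outside path_sum_eq_0 U_def)
  qed (auto simp: U_def)
  \<comment> \<open>From \<open>(Suc k, q)\<close> the jump can land only at \<open>(k, q)\<close>: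
    for \<open>i < k\<close> the second coordinate exceeds \<open>q\<close>.\<close>
  have "Z i (k + q - i) = 0" if "i < k" for i
    unfolding Z_def using that by (intro outside) (auto simp: mem_rectangle)
  then have "M k (k + q) = 0"
    by (simp add: M_def)
  then have "M (Suc k) (k + q) = Z k q * V k q"
    by (simp add: M_def)
  also have "\<dots> = Z (Suc k) q * W k q"
    using Z_V[of k q] k by (simp add: Z_def)
  finally have "U (Suc k) q * M (Suc k) (k + q) = W k q"
    using X_Y[of "Suc m" "Suc k" q] k m pos
    by (simp add: U_def Z_def mem_rectangle mult.assoc[symmetric])
  then show ?thesis
    using L[of "Suc k" q] k by (simp add: W_def)
qed

lemma path_sum_conversion_iter:
  "m + t < N \<Longrightarrow> 1 \<le> k \<Longrightarrow> k + t \<le> p \<Longrightarrow>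
    path_sum (A (m + t)) (Suc t) 1 (k + t) q = path_sum (A m) 1 1 k q"
proof (induction t)
  case (Suc t)
  then show ?case
    using path_sum_conversion[of "m + t" "Suc t" "k + t"] by simp
qed simp

lemma reciprocity_border:
  assumes "n \<le> N" "1 \<le> i" "i \<le> p" "i \<le> n"
  shows "Y n i 1 = b' * X (n - i) (p + 1 - i) q * a'"
proof -
  \<comment> \<open>Labels at time \<open>n\<close> are read off the weights at time
    \<open>n - 1 = m + t\<close>. Then \<open>t\<close> conversions bring the end cell
    \<open>(i, 1)\<close> to \<open>(1, 1)\<close>, the start cell \<open>(p, q)\<close> to
    \<open>(k, q)\<close> and the time to \<open>m\<close>.\<close>
  define t where "t = i - 1"
  define m where "m = n - i"
  define k where "k = p + 1 - i"
  have eqs: "i = Suc t" "n = Suc (m + t)" "p = k + t" and k: "1 \<le> k"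
    using assms by (auto simp: t_def m_def k_def)
  have "Y n i 1 = b' * path_sum (A (m + t)) (Suc t) 1 (k + t) q"
    using Y_path_sum[of "m + t" i 1] assms pos eqs by (simp add: mem_rectangle)
  also have "\<dots> = b' * path_sum (A m) 1 1 k q"
    using path_sum_conversion_iter[of m t k] assms k eqs by simp
  also have "\<dots> = b' * X m k q * a'"
    using X_path_sum[of m k q] assms eqs a_inv by (simp add: mult.assoc)
  finally show ?thesis by (simp add: m_def k_def)
qed

text \<open>Bracketing upper sum, weight and lower sum in two ways eliminates the weight and leaves
  the transition equation.\<close>

lemma hi_lo:
  assumes m: "m < N" and v: "(i, j) \<in> rectangle p q"
  shows "((if i = p \<and> j = q then b' else 0) + Y (Suc m) (Suc i) j + Y (Suc m) i (Suc j)) * X m i j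
    = Y (Suc m) i j * ((if i = 1 \<and> j = 1 then a else 0) + X m (i - 1) j + X m i (j - 1))"
  by (metis hi_A[OF m v] A_lo[OF m v] mult.assoc)

text \<open>The step from \<open>J\<close> to \<open>Suc J\<close> uses columns \<open>J\<close> and
  \<open>J - 1\<close>, two times and the neighbours of \<open>i\<close>; hence strong induction
  with \<open>n\<close> and \<open>i\<close> arbitrary.\<close>

theorem reciprocity:
  assumes "n \<le> N" "(i, j) \<in> rectangle p q" "i + j \<le> n + 1"
  shows "Y n i j = b' * X (n + 1 - i - j) (p + 1 - i) (q + 1 - j) * a'"
  using assms
proof (induction j arbitrary: n i rule: less_induct)
  case (less j)
  show ?case
  proof (cases "j = 1")
    case True
    then show ?thesis
      using reciprocity_border[of n i] less.prems by (simp add: mem_rectangle)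
  next
    case False
    define J where "J = j - 1"
    define n0 where "n0 = n - 1"
    define m where "m = n + 1 - i - j"
    define i' where "i' = p + 1 - i"
    define J' where "J' = q + 1 - J"
    have j: "j = Suc J" "1 \<le> J" "J < q" and n: "n = Suc n0" and i: "1 \<le> i" "i \<le> p"
      and i': "1 \<le> i'" "i' \<le> p" and J': "2 \<le> J'" "J' \<le> q"
      using False less.prems
      by (auto simp: J_def n0_def i'_def J'_def mem_rectangle)
    have mn: "m < n0" "n0 < N" "Suc m \<le> N" "i + J \<le> n0 + 1"
      using less.prems j n i by (auto simp: m_def)
    have v: "(i, J) \<in> rectangle p q" and v': "(i', J') \<in> rectangle p q"
      using i j i' J' by (auto simp: mem_rectangle)
    have IH: "Y k x y = b' * X (k + 1 - x - y) (p + 1 - x) (q + 1 - y) * a'"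
      if "y < j" "k \<le> N" "(x, y) \<in> rectangle p q" "x + y \<le> k + 1" for k x y
      using less.IH that by blast
    \<comment> \<open>The lower sums contain labels rather than inverses; for them the hypothesis is
      inverted.\<close>
    have IH': "X k x y = a * Y (k + 1 - x - y) (p + 1 - x) (q + 1 - y) * b"
      if that: "y < j" "k \<le> N" "(x, y) \<in> rectangle p q" "x + y \<le> k + 1" for k x y
    proof -
      let ?x = "X (k + 1 - x - y) (p + 1 - x) (q + 1 - y)"
        and ?y = "Y (k + 1 - x - y) (p + 1 - x) (q + 1 - y)"
      have xy: "?x * ?y = 1"
        by (rule X_Y) (use that in \<open>auto simp: mem_rectangle\<close>)
      have "Y k x y * (a * ?y * b) = b' * ?x * (a' * a) * ?y * b"
        by (simp add: IH[OF that] mult.assoc)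
      also have "\<dots> = b' * (?x * ?y) * b" by (simp add: a_inv mult.assoc)
      also have "\<dots> = 1" by (simp only: xy b_inv mult_1_right)
      finally have "X k x y * (Y k x y * (a * ?y * b)) = X k x y" by simp
      then show ?thesis
        by (simp add: mult.assoc[symmetric] X_Y[OF that(2,3)])
    qed
    let ?hi = "\<lambda>m i j. (if i = p \<and> j = q then b' else 0) + Y m (Suc i) j + Y m i (Suc j)"
    let ?lo = "\<lambda>m i j. (if i = 1 \<and> j = 1 then a else 0) + X m (i - 1) j + X m i (j - 1)"
    have Yn: "Y n i J = b' * X (Suc m) i' J' * a'"
    proof -
      have "n + 1 - i - J = Suc m" using mn n j by (auto simp: m_def)
      then show ?thesis using IH[of J n i] mn n j v by (simp add: i'_def J'_def)
    qed
    have Yn0: "Y n0 i J = b' * X m i' J' * a'"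
      using IH[of J n0 i] mn n j v by (simp add: i'_def J'_def m_def)
    \<comment> \<open>In the border case both cells lie outside the rectangle and both sides are
      \<open>0\<close>; likewise in the next two facts.\<close>
    have Yright: "Y n (Suc i) J = b' * X m (i' - 1) J' * a'"
    proof (cases "i = p")
      case True
      then show ?thesis by (simp add: i'_def)
    next
      case False
      then show ?thesis
        using IH[of J n "Suc i"] mn n j v by (simp add: i'_def J'_def m_def mem_rectangle)
    qed
    have Xleft: "X n0 (i - 1) J = a * Y (Suc m) (Suc i') J' * b"
    proof (cases "i = 1")
      case True
      then show ?thesis by (simp add: i'_def)
    next
      case False
      then have "n0 + 1 - (i - 1) - J = Suc m" "p + 1 - (i - 1) = Suc i'"
          "(i - 1, J) \<in> rectangle p q" "i - 1 + J \<le> n0 + 1"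
        using mn n j i by (auto simp: m_def i'_def mem_rectangle)
      then show ?thesis
        using IH'[of J n0 "i - 1"] mn j by (simp add: J'_def)
    qed
    have Xdown: "X n0 i (J - 1) = a * Y (Suc m) i' (Suc J') * b"
    proof (cases "J = 1")
      case True
      then show ?thesis by (simp add: J'_def)
    next
      case False
      then have "n0 + 1 - i - (J - 1) = Suc m" "q + 1 - (J - 1) = Suc J'"
          "(i, J - 1) \<in> rectangle p q" "i + (J - 1) \<le> n0 + 1"
        using mn n j i by (auto simp: m_def J'_def mem_rectangle)
      then show ?thesis
        using IH'[of "J - 1" n0 i] mn j by (simp add: i'_def)
    qed
    have corner: "(if i = 1 \<and> J = 1 then a else 0) = a * (if i' = p \<and> J' = q then b' else 0) * b"
      using i j by (auto simp: i'_def J'_def mult.assoc b_inv)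
    have lo_hi: "?lo n0 i J = a * ?hi (Suc m) i' J' * b"
      unfolding corner Xleft Xdown by (simp only: distrib_left distrib_right)
    \<comment> \<open>The transition equation at \<open>(i, J)\<close> rewrites the upper sum, the
      hypothesis moves everything to the antipode \<open>(i', J')\<close>, and the transition
      equation there yields a lower sum. As \<open>J < q\<close> and \<open>2 \<le> J'\<close>, the
      first and the last sum have no border term, and \<open>Yright\<close> cancels one term of
      each.\<close>
    have "?hi n i J = ?hi n i J * (X n0 i J * Y n0 i J)"
      using X_Y[OF _ v, of n0] mn by simp
    also have "\<dots> = Y n i J * ?lo n0 i J * Y n0 i J"
      using hi_lo[OF mn(2) v] by (simp add: n mult.assoc[symmetric])
    also have "\<dots> = b' * X (Suc m) i' J' * (a' * a) * ?hi (Suc m) i' J' * (b * b') * X m i' J' * a'"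
      unfolding Yn Yn0 lo_hi by (simp only: mult.assoc)
    also have "\<dots> = b' * X (Suc m) i' J' * (?hi (Suc m) i' J' * X m i' J') * a'"
      by (simp only: a_inv b_inv mult.assoc mult_1_left)
    also have "\<dots> = b' * (X (Suc m) i' J' * Y (Suc m) i' J') * ?lo m i' J' * a'"
      using hi_lo[OF _ v', of m] mn by (simp only: mult.assoc)
    also have "\<dots> = b' * X m (i' - 1) J' * a' + b' * X m i' (J' - 1) * a'"
      using X_Y[OF mn(3) v'] J' by (simp add: distrib_left distrib_right)
    finally have "Y n i (Suc J) = b' * X m i' (J' - 1) * a'"
      using Yright j by simp
    then show ?thesis by (simp add: j m_def i'_def J'_def)
  qed
qed

end


section \<open>Two-sided inverses\<close>

lemma ring_inverseI: "x * y = 1 \<Longrightarrow> y * x = 1 \<Longrightarrow> ring_invertible x \<and> ring_inv x = y"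
  unfolding ring_invertible_def ring_inv_def
  by (metis (mono_tags, lifting) mult.assoc mult.right_neutral mult.left_neutral the_equality)

lemma
  assumes "ring_invertible x"
  shows right_ring_inv: "x * ring_inv x = 1" and left_ring_inv: "ring_inv x * x = 1"
  using assms ring_inverseI unfolding ring_invertible_def by metis+

lemma ring_invertible_one [simp]: "ring_invertible 1"
  by (auto simp: ring_invertible_def)

lemma ring_invertible_ring_inv: "ring_invertible x \<Longrightarrow> ring_invertible (ring_inv x)"
  using left_ring_inv right_ring_inv ring_inverseI by blast

lemma ring_invertible_mult:
  assumes "ring_invertible x" "ring_invertible y"
  shows "ring_invertible (x * y)"
proof -
  obtain x' y' where *: "x * x' = 1" "x' * x = 1" "y * y' = 1" "y' * y = 1"
    using assms by (auto simp: ring_invertible_def)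
  have "x * y * (y' * x') = x * (y * y') * x'" "y' * x' * (x * y) = y' * (x' * x) * y"
    by (simp_all only: mult.assoc)
  then have "x * y * (y' * x') = 1" "y' * x' * (x * y) = 1"
    by (simp_all only: * mult_1_right)
  then show ?thesis by (auto simp: ring_invertible_def)
qed

section \<open>Rowmotion as a system of transition equations\<close>

definition lower_sum :: "'v::order set \<Rightarrow> ('v, 'k::{ring, monoid_mult}) labeling \<Rightarrow> 'v \<Rightarrow> 'k" where
  "lower_sum P f v = (\<Sum>u | covered_in P u (Fin v). f u)"

definition upper_sum :: "'v::order set \<Rightarrow> ('v, 'k::{ring, monoid_mult}) labeling \<Rightarrow> 'v \<Rightarrow> 'k" where
  "upper_sum P f v = (\<Sum>u | covered_in P (Fin v) u. ring_inv (f u))"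

text \<open>Here \<open>f\<close> is the labeling before and \<open>g\<close> the one after a whole
  rowmotion step. Larger elements are toggled first, so the toggle at \<open>v\<close> sees new
  labels above \<open>v\<close> and old ones below.\<close>

definition toggled ::
  "'v::order set \<Rightarrow> ('v, 'k::{ring, monoid_mult}) labeling \<Rightarrow> ('v, 'k) labeling \<Rightarrow> 'v \<Rightarrow> bool" where
  "toggled P f g v \<longleftrightarrow> ring_invertible (f (Fin v)) \<and>
     (\<forall>u. covered_in P (Fin v) u \<longrightarrow> ring_invertible (g u)) \<and> ring_invertible (upper_sum P g v) \<and>
     g (Fin v) = lower_sum P f v * ring_inv (f (Fin v)) * ring_inv (upper_sum P g v)"

lemma lower_sum_cong:
  "(\<And>u. covered_in P u (Fin v) \<Longrightarrow> f u = g u) \<Longrightarrow> lower_sum P f v = lower_sum P g v"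
  unfolding lower_sum_def by (intro sum.cong) auto

lemma upper_sum_cong:
  "(\<And>u. covered_in P (Fin v) u \<Longrightarrow> f u = g u) \<Longrightarrow> upper_sum P f v = upper_sum P g v"
  unfolding upper_sum_def by (intro sum.cong) auto

lemma toggle_eq_Some:
  "toggle P v f = Some g \<longleftrightarrow> ring_invertible (f (Fin v)) \<and>
     (\<forall>u. covered_in P (Fin v) u \<longrightarrow> ring_invertible (f u)) \<and> ring_invertible (upper_sum P f v) \<and>
     g = f(Fin v := lower_sum P f v * ring_inv (f (Fin v)) * ring_inv (upper_sum P f v))"
  unfolding toggle_def lower_sum_def upper_sum_def Let_def by auto

text \<open>The toggle at the head \<open>v\<close> acts last. No element of the tail lies below
  \<open>v\<close>, so the lower covers of \<open>v\<close> still carry old labels, and changing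
  \<open>v\<close> disturbs no upper sum used before.\<close>

lemma foldr_toggle:
  assumes "foldr (\<lambda>v F. toggle P v \<circ>\<^sub>m F) us Some f = Some g"
    and "distinct us" "sorted_wrt (\<lambda>x y. \<not> y < x) us"
  shows "(\<forall>u. u \<notin> Fin ` set us \<longrightarrow> g u = f u) \<and> (\<forall>v\<in>set us. toggled P f g v)"
  using assms
proof (induction us arbitrary: g)
  case (Cons v us)
  then obtain h where h: "foldr (\<lambda>v F. toggle P v \<circ>\<^sub>m F) us Some f = Some h" "toggle P v h = Some g"
    by (auto simp: map_comp_def split: option.splits)
  note IH = Cons.IH[OF h(1)]
  have us: "v \<notin> set us" "\<And>w. w \<in> set us \<Longrightarrow> \<not> w < v"
    using Cons.prems by auto
  have h_f: "h u = f u" if "u \<notin> Fin ` set us" for u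
    using IH Cons.prems that by simp
  have g_h: "g u = h u" if "u \<noteq> Fin v" for u
    using h(2) that by (simp add: toggle_eq_Some)
  have "toggled P f g v"
  proof -
    have lo: "lower_sum P h v = lower_sum P f v"
      using us by (intro lower_sum_cong h_f) (auto simp: covered_in_def)
    have up: "g u = h u" if "covered_in P (Fin v) u" for u
      using that by (intro g_h) (auto simp: covered_in_def)
    then have up_sum: "upper_sum P g v = upper_sum P h v"
      by (intro upper_sum_cong)
    moreover have "h (Fin v) = f (Fin v)"
      using us by (intro h_f) auto
    moreover have "ring_invertible (h (Fin v))" "ring_invertible (upper_sum P h v)"
      "\<forall>u. covered_in P (Fin v) u \<longrightarrow> ring_invertible (h u)"
      "g (Fin v) = lower_sum P h v * ring_inv (h (Fin v)) * ring_inv (upper_sum P h v)"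
      using h(2) by (simp_all add: toggle_eq_Some)
    ultimately show ?thesis
      by (simp add: toggled_def lo up)
  qed
  moreover have "toggled P f g w" if w: "w \<in> set us" for w
  proof -
    have up: "g u = h u" if "covered_in P (Fin w) u" for u
      using that us(2)[OF w] by (intro g_h) (auto simp: covered_in_def)
    then have "upper_sum P g w = upper_sum P h w"
      by (intro upper_sum_cong)
    moreover have "g (Fin w) = h (Fin w)"
      using w us by (intro g_h) auto
    moreover have "toggled P f h w"
      using IH Cons.prems w by simp
    ultimately show ?thesis
      by (simp add: toggled_def up)
  qed
  ultimately show ?case
    using g_h h_f by auto
qed auto

lemma rowmotion_toggled:
  assumes "linear_extension P vs" "rowmotion P vs f = Some g"
  shows "g Minf = f Minf" "g Pinf = f Pinf" "v \<in> P \<Longrightarrow> toggled P f g v"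
proof -
  have "sorted_wrt (\<lambda>x y. \<not> y < x) vs" "distinct vs" "set vs = P"
    using assms(1) by (auto simp: linear_extension_def sorted_wrt_iff_nth_less) (meson less_trans order_less_asym)
  with foldr_toggle[of P vs f g] assms(2)
  show "g Minf = f Minf" "g Pinf = f Pinf" "v \<in> P \<Longrightarrow> toggled P f g v"
    by (auto simp: rowmotion_def)
qed

section \<open>Covers in the rectangle\<close>

lemma covered_in_rectangle_Fin:
  "covered_in (rectangle p q) (Fin (x, y)) (Fin (x', y')) \<longleftrightarrow>
     (x, y) \<in> rectangle p q \<and> (x', y') \<in> rectangle p q \<and>
     (x' = Suc x \<and> y' = y \<or> x' = x \<and> y' = Suc y)"  (is "?l \<longleftrightarrow> ?r")
proof
  assume l: ?l
  then have R: "(x, y) \<in> rectangle p q" "(x', y') \<in> rectangle p q" and less: "(x, y) < (x', y')"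
    by (auto simp: covered_in_def ext_poset_def)
  have no: "\<not> ((x, y) < w \<and> w < (x', y'))" if "w \<in> rectangle p q" for w
    using l that by (auto simp: covered_in_def ext_poset_def)
  show ?r
  \<comment> \<open>A unit step towards \<open>(x', y')\<close> stays in the rectangle, so it must
    already arrive there.\<close>
  proof (cases "x < x'")
    case True
    then show ?thesis
      using no[of "(Suc x, y)"] R less by (auto simp: less_prod_def mem_rectangle)
  next
    case False
    then show ?thesis
      using no[of "(x, Suc y)"] R less by (auto simp: less_prod_def mem_rectangle)
  qed
next
  assume ?r
  then show ?l
    by (auto simp: covered_in_def ext_poset_def less_prod_def)
qed

lemma covered_in_rectangle_Minf:
  "covered_in (rectangle p q) Minf (Fin (x, y)) \<longleftrightarrow> (x, y) \<in> rectangle p q \<and> x = 1 \<and> y = 1"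
proof -
  have "covered_in (rectangle p q) Minf (Fin (x, y)) \<longleftrightarrow>
      (x, y) \<in> rectangle p q \<and> \<not> (\<exists>w\<in>rectangle p q. w < (x, y))"
    by (auto simp: covered_in_def ext_poset_def)
  also have "\<dots> \<longleftrightarrow> (x, y) \<in> rectangle p q \<and> x = 1 \<and> y = 1"
  proof (intro conj_cong refl iffI)
    assume "(x, y) \<in> rectangle p q" "\<not> (\<exists>w\<in>rectangle p q. w < (x, y))"
    then have "\<not> (1, 1) < (x, y)" "1 \<le> x" "1 \<le> y"
      by (auto simp: mem_rectangle)
    then show "x = 1 \<and> y = 1" by (auto simp: less_prod_def)
  qed (auto simp: mem_rectangle less_prod_def)
  finally show ?thesis .
qed

lemma covered_in_rectangle_Pinf:
  "covered_in (rectangle p q) (Fin (x, y)) Pinf \<longleftrightarrow> (x, y) \<in> rectangle p q \<and> x = p \<and> y = q"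
proof -
  have "covered_in (rectangle p q) (Fin (x, y)) Pinf \<longleftrightarrow>
      (x, y) \<in> rectangle p q \<and> \<not> (\<exists>w\<in>rectangle p q. (x, y) < w)"
    by (auto simp: covered_in_def ext_poset_def)
  also have "\<dots> \<longleftrightarrow> (x, y) \<in> rectangle p q \<and> x = p \<and> y = q"
  proof (intro conj_cong refl iffI)
    assume "(x, y) \<in> rectangle p q" "\<not> (\<exists>w\<in>rectangle p q. (x, y) < w)"
    then have "\<not> (x, y) < (p, q)" "x \<le> p" "y \<le> q"
      by (auto simp: mem_rectangle)
    then show "x = p \<and> y = q" by (auto simp: less_prod_def)
  qed (auto simp: mem_rectangle less_prod_def)
  finally show ?thesis .
qed

lemma lower_sum_rectangle:
  fixes f :: "(nat \<times> nat, 'k::{ring, monoid_mult}) labeling"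
  assumes v: "(i, j) \<in> rectangle p q"
  defines "X \<equiv> \<lambda>i j. if (i, j) \<in> rectangle p q then f (Fin (i, j)) else 0"
  shows "lower_sum (rectangle p q) f (i, j) =
    (if i = 1 \<and> j = 1 then f Minf else 0) + X (i - 1) j + X i (j - 1)"
proof -
  have "{u. covered_in (rectangle p q) u (Fin (i, j))} = (if i = 1 \<and> j = 1 then {Minf} else {})
      \<union> (if i = 1 then {} else {Fin (i - 1, j)}) \<union> (if j = 1 then {} else {Fin (i, j - 1)})"
    (is "?S = ?T")
  proof (rule set_eqI)
    fix u
    show "u \<in> ?S \<longleftrightarrow> u \<in> ?T"
    proof (cases u)
      case (Fin w)
      then show ?thesis
        using v by (cases w) (auto simp: covered_in_rectangle_Fin mem_rectangle)
    qed (use v in \<open>auto simp: covered_in_rectangle_Minf, auto simp: covered_in_def\<close>)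
  qed
  then show ?thesis
    using v unfolding lower_sum_def by (auto simp: X_def mem_rectangle)
qed

lemma upper_sum_rectangle:
  fixes f :: "(nat \<times> nat, 'k::{ring, monoid_mult}) labeling"
  assumes v: "(i, j) \<in> rectangle p q"
  defines "Y \<equiv> \<lambda>i j. if (i, j) \<in> rectangle p q then ring_inv (f (Fin (i, j))) else 0"
  shows "upper_sum (rectangle p q) f (i, j) =
    (if i = p \<and> j = q then ring_inv (f Pinf) else 0) + Y (Suc i) j + Y i (Suc j)"
proof -
  have "{u. covered_in (rectangle p q) (Fin (i, j)) u} = (if i = p \<and> j = q then {Pinf} else {})
      \<union> (if i = p then {} else {Fin (Suc i, j)}) \<union> (if j = q then {} else {Fin (i, Suc j)})"
    (is "?S = ?T")
  proof (rule set_eqI)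
    fix u
    show "u \<in> ?S \<longleftrightarrow> u \<in> ?T"
    proof (cases u)
      case (Fin w)
      then show ?thesis
        using v by (cases w) (auto simp: covered_in_rectangle_Fin mem_rectangle)
    qed (use v in \<open>auto simp: covered_in_rectangle_Pinf, auto simp: covered_in_def\<close>)
  qed
  then show ?thesis
    using v unfolding upper_sum_def by (auto simp: Y_def mem_rectangle)
qed

section \<open>Transfer to rowmotion orbits\<close>

lemma reciprocity_of_toggled:
  fixes F :: "nat \<Rightarrow> (nat \<times> nat, 'k::{ring, monoid_mult}) labeling"
  assumes pos: "0 < p" "0 < q" "0 < N"
    and a: "\<And>m. m \<le> N \<Longrightarrow> F m Minf = a" "ring_invertible a"
    and b: "\<And>m. m \<le> N \<Longrightarrow> F m Pinf = b"
    and step: "\<And>m v. m < N \<Longrightarrow> v \<in> rectangle p q \<Longrightarrow> toggled (rectangle p q) (F m) (F (Suc m)) v"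
    and ij: "(i, j) \<in> rectangle p q" "i + j \<le> N + 1"
  defines "w \<equiv> F (N + 1 - i - j) (Fin (p + 1 - i, q + 1 - j))"
  shows "ring_invertible w \<and> F N (Fin (i, j)) = a * ring_inv w * b"
proof -
  let ?R = "rectangle p q"
  define X where "X m i j = (if (i, j) \<in> ?R then F m (Fin (i, j)) else 0)" for m i j
  define Y where "Y m i j = (if (i, j) \<in> ?R then ring_inv (F m (Fin (i, j))) else 0)" for m i j
  \<comment> \<open>This form of the weight inverts only elements known to be units; invertibility
    of the lower sum is not presupposed.\<close>
  define A where "A m i j = (if (i, j) \<in> ?R
    then ring_inv (upper_sum ?R (F (Suc m)) (i, j)) * ring_inv (F (Suc m) (Fin (i, j))) else 0)" for m i j
  have "covered_in ?R (Fin (p, q)) Pinf" "(p, q) \<in> ?R"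
    using pos by (auto simp: covered_in_rectangle_Pinf mem_rectangle)
  then have b_unit: "ring_invertible b"
    using step[of 0 "(p, q)"] b[of "Suc 0"] pos by (auto simp: toggled_def)
  \<comment> \<open>No step after time \<open>N\<close> certifies these labels. Every cell but
    \<open>(1, 1)\<close> is an upper cover, so the last step already requires its label to be a
    unit; at \<open>(1, 1)\<close> the lower sum is \<open>a\<close> and the new label a product of
    units.\<close>
  have last: "ring_invertible (F N (Fin (x, y)))" if xy: "(x, y) \<in> ?R" for x y
  proof -
    obtain N' where N: "N = Suc N'" using pos by (cases N) auto
    have upper: "ring_invertible (F N u)" if "covered_in ?R (Fin v) u" for u v
      using step[of N' v] that N by (auto simp: toggled_def covered_in_def ext_poset_def)
    consider "x = 1" "y = 1" | "1 < x" | "1 < y"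
      using xy by (fastforce simp: mem_rectangle)
    then show ?thesis
    proof cases
      case 1
      have "toggled ?R (F N') (F N) (x, y)"
        using step[of N' "(x, y)"] N xy by simp
      moreover have "lower_sum ?R (F N') (x, y) = a"
        using lower_sum_rectangle[OF xy, of "F N'"] 1 a(1)[of N'] N by (simp add: mem_rectangle)
      ultimately show ?thesis
        using a(2) by (simp add: toggled_def ring_invertible_mult ring_invertible_ring_inv)
    next
      case 2
      then show ?thesis
        using xy by (intro upper[of "(x - 1, y)"]) (auto simp: covered_in_rectangle_Fin mem_rectangle)
    next
      case 3
      then show ?thesis
        using xy by (intro upper[of "(x, y - 1)"]) (auto simp: covered_in_rectangle_Fin mem_rectangle)
    qed
  qed
  have unit: "ring_invertible (F m (Fin (x, y)))" if "m \<le> N" "(x, y) \<in> ?R" for m x y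
  proof (cases "m = N")
    case False
    then show ?thesis using step[of m "(x, y)"] that by (auto simp: toggled_def)
  qed (use last that in simp)
  interpret rectangle_orbit p q N X Y A a "ring_inv a" b "ring_inv b"
  proof
    fix m x y
    assume m: "m < N" and xy: "(x, y) \<in> ?R"
    let ?f = "F m (Fin (x, y))" and ?g = "F (Suc m) (Fin (x, y))"
    let ?lo = "lower_sum ?R (F m) (x, y)" and ?hi = "upper_sum ?R (F (Suc m)) (x, y)"
    have units: "ring_invertible ?f" "ring_invertible ?g" "ring_invertible ?hi"
      and g: "?g = ?lo * ring_inv ?f * ring_inv ?hi"
      using step[OF m xy] unit[OF _ xy, of "Suc m"] m by (auto simp: toggled_def)
    have "?g * ?hi * ?f = ?lo * ring_inv ?f * (ring_inv ?hi * ?hi) * ?f"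
      by (subst g) (simp only: mult.assoc)
    also have "\<dots> = ?lo * (ring_inv ?f * ?f)"
      by (simp only: left_ring_inv units mult_1_right mult.assoc)
    finally have "?lo = ?g * ?hi * ?f"
      by (simp add: left_ring_inv units)
    then have "A m x y * ?lo = ring_inv ?hi * (ring_inv ?g * ?g) * ?hi * ?f"
      using xy by (simp add: A_def mult.assoc)
    also have "\<dots> = (ring_inv ?hi * ?hi) * ?f"
      by (simp only: left_ring_inv units mult_1_right)
    moreover have "?lo = (if x = 1 \<and> y = 1 then a else 0) + X m (x - 1) y + X m x (y - 1)"
      using lower_sum_rectangle[OF xy, of "F m"] a(1)[of m] m by (simp only: X_def less_imp_le)
    ultimately show "A m x y * ((if x = 1 \<and> y = 1 then a else 0) + X m (x - 1) y + X m x (y - 1)) = X m x y"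
      using xy by (simp only: X_def if_True left_ring_inv units mult_1_left)
    have "?hi * A m x y = Y (Suc m) x y"
      using xy by (simp add: A_def Y_def mult.assoc[symmetric] right_ring_inv units)
    moreover have "?hi = (if x = p \<and> y = q then ring_inv b else 0) + Y (Suc m) (Suc x) y + Y (Suc m) x (Suc y)"
      using upper_sum_rectangle[OF xy, of "F (Suc m)"] b[of "Suc m"] m by (simp only: Y_def Suc_leI)
    ultimately show "((if x = p \<and> y = q then ring_inv b else 0) + Y (Suc m) (Suc x) y + Y (Suc m) x (Suc y))
        * A m x y = Y (Suc m) x y"
      by (simp only:)
  qed (use pos a b_unit unit in \<open>auto simp: X_def Y_def A_def left_ring_inv right_ring_inv\<close>)
  have v': "(p + 1 - i, q + 1 - j) \<in> ?R"
    using ij by (auto simp: mem_rectangle)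
  have w: "ring_invertible w"
    unfolding w_def by (rule unit) (use v' ij in \<open>auto simp: mem_rectangle\<close>)
  have "ring_inv (F N (Fin (i, j))) = ring_inv b * w * ring_inv a"
    using reciprocity[of N i j] ij v' by (simp add: X_def Y_def w_def)
  then have "F N (Fin (i, j)) * (ring_inv b * w * ring_inv a) = 1"
    using right_ring_inv[OF last[OF ij(1)]] by simp
  then have "F N (Fin (i, j)) * (ring_inv b * w * ring_inv a) * (a * ring_inv w * b) = a * ring_inv w * b"
    by simp
  moreover have "(ring_inv b * w * ring_inv a) * (a * ring_inv w * b) = 1"
  proof -
    have "(ring_inv b * w * ring_inv a) * (a * ring_inv w * b)
        = ring_inv b * (w * (ring_inv a * a) * ring_inv w) * b"
      by (simp only: mult.assoc)
    also have "\<dots> = 1"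
      by (simp only: left_ring_inv right_ring_inv a(2) b_unit w mult_1_right)
    finally show ?thesis .
  qed
  ultimately show ?thesis
    using w by (simp add: mult.assoc)
qed

lemma partial_power_defined:
  "partial_power F l f \<noteq> None \<Longrightarrow> m \<le> l \<Longrightarrow> partial_power F m f \<noteq> None"
proof (induction l)
  case (Suc l)
  then show ?case by (cases "m = Suc l") (auto simp: map_comp_def split: option.splits)
qed simp

theorem theorem4p8:
  fixes p q l i j :: nat
    and P :: "(nat \<times> nat) set"
    and vs :: "(nat \<times> nat) list"
    and R :: "(nat \<times> nat, 'k::{ring, monoid_mult}) labeling \<Rightarrow> (nat \<times> nat, 'k) labeling option"
    and f :: "(nat \<times> nat, 'k) labeling"
    and a b :: 'k
  assumes "p > 0" and "q > 0"
    and "P = rectangle p q"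
    and "linear_extension P vs"
    and "R = rowmotion P vs"
    and "partial_power R l f \<noteq> None"
    and "a = f Minf" and "b = f Pinf"
    and "(i, j) \<in> P"
    and "int l - int i - int j + 1 \<ge> 0"
  shows "\<exists>g h. partial_power R l f = Some g \<and>
           partial_power R (nat (int l - int i - int j + 1)) f = Some h \<and>
           ring_invertible (h (Fin (p + 1 - i, q + 1 - j))) \<and>
           g (Fin (i, j)) = a * ring_inv (h (Fin (p + 1 - i, q + 1 - j))) * b"
proof -
  define F where "F m = the (partial_power R m f)" for m
  have F: "partial_power R m f = Some (F m)" if "m \<le> l" for m
    using partial_power_defined[OF assms(6) that] by (simp add: F_def)
  have F0: "F 0 = f" by (simp add: F_def)
  have "rowmotion P vs (F m) = Some (F (Suc m))" if "m < l" for m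
    using F[of m] F[of "Suc m"] that assms(5) by (simp add: map_comp_def)
  note step = rowmotion_toggled[OF assms(4) this]
  have ends: "F m Minf = a \<and> F m Pinf = b" if "m \<le> l" for m
    using that
  proof (induction m)
    case (Suc m)
    then show ?case using step(1,2)[of m] by simp
  qed (simp add: F0 assms(7,8))
  have ij: "(i, j) \<in> rectangle p q" "1 \<le> i" "1 \<le> j" "i + j \<le> l + 1"
    using assms(3,9,10) by (auto simp: mem_rectangle)
  have origin: "(1, 1) \<in> rectangle p q"
    using assms(1,2) by (auto simp: mem_rectangle)
  have lower_origin: "lower_sum (rectangle p q) g (1, 1) = g Minf"
    for g :: "(nat \<times> nat, 'k) labeling"
    using lower_sum_rectangle[OF origin, of g] by (simp add: mem_rectangle)
  let ?w = "F (l + 1 - i - j) (Fin (p + 1 - i, q + 1 - j))"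
  have "ring_invertible ?w \<and> F l (Fin (i, j)) = a * ring_inv ?w * b"
  proof (cases "l = 1")
    case False
    then have l: "1 < l" using ij by simp
    let ?hi = "upper_sum (rectangle p q) (F 1) (1, 1)"
    \<comment> \<open>The second step inverts the label of \<open>(1, 1)\<close> at time
      \<open>1\<close>. Solving the first transition equation for \<open>a\<close> then exhibits
      \<open>a\<close> as a product of three units.\<close>
    have "toggled P (F 0) (F 1) (1, 1)" "toggled P (F 1) (F 2) (1, 1)"
      using step(3)[of 0 "(1, 1)"] step(3)[of 1 "(1, 1)"] l origin assms(3) by (simp_all add: numeral_2_eq_2)
    then have units: "ring_invertible (F 0 (Fin (1, 1)))" "ring_invertible (F 1 (Fin (1, 1)))"
        "ring_invertible ?hi"
      and F1: "F 1 (Fin (1, 1)) = a * ring_inv (F 0 (Fin (1, 1))) * ring_inv ?hi"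
      using lower_origin[of "F 0"] ends[of 0] unfolding toggled_def assms(3) by simp_all
    have "F 1 (Fin (1, 1)) * ?hi * F 0 (Fin (1, 1))
        = a * ring_inv (F 0 (Fin (1, 1))) * (ring_inv ?hi * ?hi) * F 0 (Fin (1, 1))"
      by (subst F1) (simp only: mult.assoc)
    also have "\<dots> = a * (ring_inv (F 0 (Fin (1, 1))) * F 0 (Fin (1, 1)))"
      by (simp only: left_ring_inv units mult_1_right mult.assoc)
    finally have "a = F 1 (Fin (1, 1)) * ?hi * F 0 (Fin (1, 1))"
      by (simp only: left_ring_inv units mult_1_right)
    with units have "ring_invertible a"
      by (metis ring_invertible_mult)
    then show ?thesis
      using reciprocity_of_toggled[of p q l F a b i j] step(3) ends ij l assms(1-3) by simp
  next
    case True
    then have [simp]: "i = 1" "j = 1" using ij by auto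
    txt \<open>Here \<open>a\<close> need not be invertible. As it enters only the last toggle, and only as a left
      factor, it may be replaced by \<open>1\<close>.\<close>
    define c where "c = ring_inv (F 0 (Fin (1, 1))) * ring_inv (upper_sum P (F 1) (1, 1))"
    define G where "G m = (if m = 0 then (F 0)(Minf := 1) else (F 1)(Minf := 1, Fin (1, 1) := c))" for m :: nat
    have G: "toggled P (G 0) (G 1) v" if v: "v \<in> rectangle p q" for v
    proof -
      \<comment> \<open>Neither \<open>Minf\<close> nor \<open>(1, 1)\<close> covers a cell, so the
        modified labels enter no upper sum.\<close>
      have up: "G 1 u = F 1 u" if "covered_in P (Fin v) u" for u
      proof -
        have "u \<noteq> Minf" "u \<noteq> Fin (1, 1)"
          using that v by (cases v, auto simp: covered_in_def mem_rectangle less_prod_def)+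
        then show ?thesis by (simp add: G_def)
      qed
      then have up_sum: "upper_sum P (G 1) v = upper_sum P (F 1) v"
        by (rule upper_sum_cong)
      have tog: "toggled P (F 0) (F 1) v"
        using step(3)[of 0 v] True v assms(3) by simp
      show ?thesis
      proof (cases "v = (1, 1)")
        case True
        then show ?thesis
          using tog up up_sum lower_origin[of "G 0"] assms(3)
          by (auto simp: toggled_def G_def c_def)
      next
        case False
        have "lower_sum P (G 0) v = lower_sum P (F 0) v"
          using False assms(3)
          by (intro lower_sum_cong) (cases v, auto simp: G_def covered_in_rectangle_Minf)
        then show ?thesis
          using tog up up_sum False by (auto simp: toggled_def G_def)
      qed
    qed
    have "ring_invertible (G 0 (Fin (p, q))) \<and> G 1 (Fin (1, 1)) = 1 * ring_inv (G 0 (Fin (p, q))) * b"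
      using reciprocity_of_toggled[of p q 1 G 1 b 1 1] G ends[of 0] ends[of 1] origin True assms(1-3)
      by (auto simp: G_def)
    moreover have "F 1 (Fin (1, 1)) = a * c"
      using step(3)[of 0 "(1, 1)"] True origin assms(3) lower_origin[of "F 0"] ends[of 0]
      by (simp add: toggled_def c_def mult.assoc)
    ultimately show ?thesis
      using True by (simp add: G_def mult.assoc)
  qed
  moreover have "nat (int l - int i - int j + 1) = l + 1 - i - j"
    using ij by simp
  ultimately show ?thesis
    using F[of l] F[of "l + 1 - i - j"] ij by auto
qed

end
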